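(* Let $n\ge1$ and let $\chi:\{1,\dots,n\}\to\{\bullet,\circ\}$ be a map. Then $INC(\chi)$, the set of interval-noncrossing partitions with respect to $\chi$, is a lattice with respect to the reverse refinement order $\le$ on partitions.
   Context: For partitions $\sigma,\pi$ of $[n]=\{1,\dots,n\}$, $\sigma\le\pi$ (reverse refinement order) means each block of $\sigma$ is contained in a block of $\pi$. A partition is noncrossing if there are no $s_1<r_1<s_2<r_2$ with $s_1,s_2$ in one block and $r_1,r_2$ in a different block. A block $V$ of $\pi$ is inner if there are a block $W\in\pi$ and $s,t\in W$ such that $s<v<t$ for all $v\in V$. A partition $\pi$ of $[n]$ is interval-noncrossing with respect to $\chi$ if $\pi$ is noncrossing and no element of $\chi^{-1}(\circ)$ is contained in an inner block of $\pi$; $INC(\chi)$ is the set of all such partitions. *)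

theory Defs
  imports "HOL-Library.Disjoint_Sets" "HOL-Algebra.Lattice"
begin

datatype colour = Bullet | Circ

definition noncrossing :: "nat set set \<Rightarrow> bool" where
  "noncrossing P \<longleftrightarrow>
     \<not> (\<exists>V\<in>P. \<exists>W\<in>P. V \<noteq> W \<and>
          (\<exists>s1 r1 s2 r2. s1 < r1 \<and> r1 < s2 \<and> s2 < r2 \<and>
             s1 \<in> V \<and> s2 \<in> V \<and> r1 \<in> W \<and> r2 \<in> W))"

definition inner_block :: "nat set set \<Rightarrow> nat set \<Rightarrow> bool" where
  "inner_block P V \<longleftrightarrow> V \<in> P \<and> (\<exists>W\<in>P. \<exists>s\<in>W. \<exists>t\<in>W. \<forall>v\<in>V. s < v \<and> v < t)"

(* chi is a total function on nat, but only its values on {1..n} matter *)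
definition INC :: "nat \<Rightarrow> (nat \<Rightarrow> colour) \<Rightarrow> nat set set set" where
  "INC n chi =
     {P. partition_on {1..n} P \<and> noncrossing P \<and>
         (\<forall>i\<in>{1..n}. chi i = Circ \<longrightarrow> \<not> (\<exists>V. inner_block P V \<and> i \<in> V))}"

definition INC_order :: "nat \<Rightarrow> (nat \<Rightarrow> colour) \<Rightarrow> nat set set gorder" where
  "INC_order n chi = \<lparr>carrier = INC n chi, eq = (=), le = refines {1..n}\<rparr>"

end

theory Submission
  imports Defs "HOL-Algebra.Complete_Lattice"
begin

text \<open>
  Regard a partition as the equivalence relation of lying in a common block. Meets of partitions are
  then intersections of relations, and any property expressed by Horn clauses, each deriving one
  instance of the relation from others, survives arbitrary intersections. Being interval-noncrossing is
  such a property: \<open>noncrossing_iff_same_block\<close> says that if \<open>a < b < c < d\<close> with \<open>a \<sim> c\<close> and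
  \<open>b \<sim> d\<close>, then \<open>a \<sim> b\<close>; and \<open>INC_iff_same_block\<close> says that in the presence of this clause the
  condition on inner blocks becomes the clause that, for \<open>s < i < t\<close> with \<open>i\<close> of colour \<open>\<circ>\<close>,
  \<open>s \<sim> t\<close> implies \<open>s \<sim> i\<close>.

  So \<open>INC(\<chi>)\<close> is closed under common refinement of nonempty families
  (\<open>common_refinement_in_INC\<close>) and contains the one-block partition, the greatest of all
  partitions. An order with a greatest element and all nonempty meets is a complete lattice, the join
  of a family being the meet of its upper bounds. This detour is needed for joins: two
  interval-noncrossing partitions may have a crossing join among all partitions.
\<close>

definition same_block :: "'a set set \<Rightarrow> 'a \<Rightarrow> 'a \<Rightarrow> bool" where
  "same_block P x y \<longleftrightarrow> (\<exists>V\<in>P. x \<in> V \<and> y \<in> V)"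

lemma same_block_iff:
  assumes "partition_on A P" "V \<in> P" "x \<in> V"
  shows "same_block P x y \<longleftrightarrow> y \<in> V"
  using assms unfolding same_block_def partition_on_def disjoint_def by blast

lemma same_block_common_refinement:
  assumes "\<P> \<noteq> {}"
  shows "same_block (common_refinement \<P>) x y \<longleftrightarrow> (\<forall>P\<in>\<P>. same_block P x y)"
proof
  assume "same_block (common_refinement \<P>) x y"
  then show "\<forall>P\<in>\<P>. same_block P x y"
    unfolding same_block_def by (meson common_refinement_exists subsetD)
next
  assume "\<forall>P\<in>\<P>. same_block P x y"
  then obtain F where F: "\<And>P. P \<in> \<P> \<Longrightarrow> F P \<in> P \<and> x \<in> F P \<and> y \<in> F P"
    unfolding same_block_def by metis
  then have "x \<in> \<Inter> (F ` \<P>)" "y \<in> \<Inter> (F ` \<P>)" "F \<in> (\<Pi> P\<in>\<P>. P)"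
    by auto
  moreover from this have "\<Inter> (F ` \<P>) \<in> common_refinement \<P>"
    unfolding common_refinement by blast
  ultimately show "same_block (common_refinement \<P>) x y"
    unfolding same_block_def by blast
qed

lemma noncrossingD:
  assumes "noncrossing P" "V \<in> P" "W \<in> P" "a \<in> V" "c \<in> V" "b \<in> W" "d \<in> W"
    "a < b" "b < c" "c < d"
  shows "V = W"
proof (rule ccontr)
  assume "V \<noteq> W"
  with assms(2-) have "\<exists>V\<in>P. \<exists>W\<in>P. V \<noteq> W \<and>
      (\<exists>s1 r1 s2 r2. s1 < r1 \<and> r1 < s2 \<and> s2 < r2 \<and> s1 \<in> V \<and> s2 \<in> V \<and> r1 \<in> W \<and> r2 \<in> W)"
    by (intro bexI[of _ V] bexI[of _ W] conjI exI[of _ a] exI[of _ b] exI[of _ c] exI[of _ d])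
  with assms(1) show False
    unfolding noncrossing_def by (rule notE)
qed

lemma noncrossing_iff_same_block:
  assumes "partition_on A P"
  shows "noncrossing P \<longleftrightarrow>
    (\<forall>a b c d. a < b \<and> b < c \<and> c < d \<and> same_block P a c \<and> same_block P b d \<longrightarrow> same_block P a b)"
    (is "_ \<longleftrightarrow> ?horn")
proof
  assume nc: "noncrossing P"
  show ?horn
  proof (intro allI impI, elim conjE)
    fix a b c d
    assume less: "a < b" "b < c" "c < d" and "same_block P a c" "same_block P b d"
    then obtain V W where V: "V \<in> P" "a \<in> V" "c \<in> V" and W: "W \<in> P" "b \<in> W" "d \<in> W"
      by (auto simp: same_block_def)
    have "V = W"
      by (rule noncrossingD[OF nc V(1) W(1) V(2,3) W(2,3) less])
    with V W show "same_block P a b"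
      by (auto simp: same_block_def)
  qed
next
  assume horn: ?horn
  show "noncrossing P"
    unfolding noncrossing_def
  proof (intro notI, elim bexE conjE exE)
    fix V W a b c d
    assume VW: "V \<in> P" "W \<in> P" "V \<noteq> W" and less: "a < b" "b < c" "c < d"
      and mem: "a \<in> V" "c \<in> V" "b \<in> W" "d \<in> W"
    have "same_block P a c" "same_block P b d"
      using VW mem by (auto simp: same_block_def)
    then have "same_block P a b"
      using horn[rule_format, of a b c d] less by simp
    then have "b \<in> V"
      by (simp add: same_block_iff[OF assms VW(1) mem(1)])
    then show False
      using disjointD[OF partition_onD2[OF assms] VW] mem(3) by auto
  qed
qed

text \<open>
  By noncrossingness, a block that meets the open interval between two points of another block lies
  entirely in that interval. Hence a point \<open>i\<close> lies in an inner block as soon as some \<open>s < i < t\<close>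
  share a block that does not contain \<open>i\<close>.
\<close>

lemma in_inner_block_iff:
  assumes part: "partition_on A P" and nc: "noncrossing P" and "i \<in> A"
  shows "(\<exists>V. inner_block P V \<and> i \<in> V) \<longleftrightarrow>
    (\<exists>s t. s < i \<and> i < t \<and> same_block P s t \<and> \<not> same_block P s i)"
proof
  assume "\<exists>V. inner_block P V \<and> i \<in> V"
  then obtain V W s t where V: "V \<in> P" "i \<in> V" and W: "W \<in> P" "s \<in> W" "t \<in> W"
    and between: "\<forall>v\<in>V. s < v \<and> v < t"
    unfolding inner_block_def by blast
  have "s \<notin> V"
    using between by blast
  then have "i \<notin> W"
    using disjointD[OF partition_onD2[OF part] V(1) W(1)] V(2) W(2) by auto
  then have "same_block P s t" "\<not> same_block P s i"
    using same_block_iff[OF part W(1,2)] W(3) by simp_all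
  with between V show "\<exists>s t. s < i \<and> i < t \<and> same_block P s t \<and> \<not> same_block P s i"
    by blast
next
  assume "\<exists>s t. s < i \<and> i < t \<and> same_block P s t \<and> \<not> same_block P s i"
  then obtain s t W where less: "s < i" "i < t" and W: "W \<in> P" "s \<in> W" "t \<in> W" and "i \<notin> W"
    by (auto simp: same_block_def)
  obtain V where V: "V \<in> P" "i \<in> V"
    using part \<open>i \<in> A\<close> unfolding partition_on_def by blast
  with \<open>i \<notin> W\<close> have "V \<noteq> W"
    by blast
  then have "s \<notin> V" "t \<notin> V"
    using disjointD[OF partition_onD2[OF part] V(1) W(1)] W by auto
  have "s < v \<and> v < t" if "v \<in> V" for v
  proof -
    \<comment> \<open>\<open>v < s < i < t\<close> and \<open>s < i < t < v\<close> would both be crossings.\<close>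
    have "\<not> v < s"
      using noncrossingD[OF nc V(1) W(1) that V(2) W(2,3)] \<open>V \<noteq> W\<close> less by auto
    moreover have "\<not> t < v"
      using noncrossingD[OF nc W(1) V(1) W(2,3) V(2) that] \<open>V \<noteq> W\<close> less by auto
    ultimately show ?thesis
      using that \<open>s \<notin> V\<close> \<open>t \<notin> V\<close> by (metis linorder_neqE_nat)
  qed
  with V W show "\<exists>V. inner_block P V \<and> i \<in> V"
    unfolding inner_block_def by blast
qed

lemma INC_iff_same_block:
  "P \<in> INC n chi \<longleftrightarrow> partition_on {1..n} P \<and>
    (\<forall>a b c d. a < b \<and> b < c \<and> c < d \<and> same_block P a c \<and> same_block P b d \<longrightarrow> same_block P a b) \<and>
    (\<forall>i\<in>{1..n}. chi i = Circ \<longrightarrow> (\<forall>s t. s < i \<and> i < t \<and> same_block P s t \<longrightarrow> same_block P s i))"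
proof (cases "partition_on {1..n} P")
  case True
  have inner: "\<not> (\<exists>V. inner_block P V \<and> i \<in> V) \<longleftrightarrow>
      (\<forall>s t. s < i \<and> i < t \<and> same_block P s t \<longrightarrow> same_block P s i)"
    if "noncrossing P" "i \<in> {1..n}" for i
    unfolding in_inner_block_iff[OF True that] by blast
  show ?thesis
    unfolding INC_def mem_Collect_eq noncrossing_iff_same_block[OF True, symmetric]
    by (intro conj_cong refl ball_cong imp_cong inner)
next
  case False
  then show ?thesis
    by (simp only: INC_def mem_Collect_eq simp_thms)
qed

lemma common_refinement_in_INC:
  assumes sub: "\<P> \<subseteq> INC n chi" and ne: "\<P> \<noteq> {}"
  shows "common_refinement \<P> \<in> INC n chi"
proof -
  note INC = subsetD[OF sub, unfolded INC_iff_same_block]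
  have nc: "same_block P a b"
    if "P \<in> \<P>" "a < b \<and> b < c \<and> c < d \<and> same_block P a c \<and> same_block P b d" for P a b c d
    using INC[OF that(1), THEN conjunct2, THEN conjunct1, rule_format, OF that(2)] .
  have circ: "same_block P s i"
    if "P \<in> \<P>" "i \<in> {1..n}" "chi i = Circ" "s < i \<and> i < t \<and> same_block P s t" for P i s t
    using INC[OF that(1), THEN conjunct2, THEN conjunct2, rule_format, OF that(2-4)] .
  have "partition_on {1..n} (common_refinement \<P>)"
    by (rule partition_on_common_refinement[OF INC[THEN conjunct1] ne])
  moreover have "\<forall>a b c d. a < b \<and> b < c \<and> c < d \<and>
      (\<forall>P\<in>\<P>. same_block P a c) \<and> (\<forall>P\<in>\<P>. same_block P b d) \<longrightarrow> (\<forall>P\<in>\<P>. same_block P a b)"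
  proof (intro allI impI ballI)
    fix a b c d P
    assume *: "a < b \<and> b < c \<and> c < d \<and> (\<forall>P\<in>\<P>. same_block P a c) \<and> (\<forall>P\<in>\<P>. same_block P b d)"
      and P: "P \<in> \<P>"
    show "same_block P a b"
      by (rule nc[OF P, of a b c d]) (use * P in simp)
  qed
  moreover have "\<forall>i\<in>{1..n}. chi i = Circ \<longrightarrow>
      (\<forall>s t. s < i \<and> i < t \<and> (\<forall>P\<in>\<P>. same_block P s t) \<longrightarrow> (\<forall>P\<in>\<P>. same_block P s i))"
  proof (intro allI impI ballI)
    fix i s t P
    assume *: "i \<in> {1..n}" "chi i = Circ" "s < i \<and> i < t \<and> (\<forall>P\<in>\<P>. same_block P s t)"
      and P: "P \<in> \<P>"
    show "same_block P s i"
      by (rule circ[OF P *(1,2), of s t]) (use * P in simp)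
  qed
  ultimately show ?thesis
    unfolding INC_iff_same_block same_block_common_refinement[OF ne] by (intro conjI)
qed

lemma one_block_in_INC:
  assumes "n \<ge> 1"
  shows "{{1..n}} \<in> INC n chi"
proof -
  have "partition_on {1..n} {{1..n}}"
    using assms by (intro partition_on_space) auto
  then show ?thesis
    unfolding INC_iff_same_block same_block_def by auto
qed

lemma INC_complete_lattice:
  assumes "n \<ge> 1"
  shows "complete_lattice (INC_order n chi)"
proof -
  have part: "partition_on {1..n} P" if "P \<in> INC n chi" for P
    using that by (simp add: INC_def)
  interpret partial_order "INC_order n chi"
    by (unfold_locales; simp add: INC_order_def del: One_nat_def)
      (erule refines_refl[OF part] refines_asym refines_trans; assumption)+
  show ?thesis
  proof (rule complete_lattice_criterion1)
    have "refines {1..n} P {{1..n}}" if "P \<in> INC n chi" for P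
      using part[OF that] part[OF one_block_in_INC[OF assms, of chi]]
      unfolding refines_def by (auto simp: partition_on_def)
    then have "greatest (INC_order n chi) {{1..n}} (carrier (INC_order n chi))"
      using one_block_in_INC[OF assms] by (simp add: greatest_def INC_order_def)
    then show "\<exists>g. greatest (INC_order n chi) g (carrier (INC_order n chi))" ..
  next
    fix \<P>
    assume sub: "\<P> \<subseteq> carrier (INC_order n chi)" and ne: "\<P> \<noteq> {}"
    then have INC: "\<P> \<subseteq> INC n chi"
      by (simp add: INC_order_def)
    then have parts: "\<And>P. P \<in> \<P> \<Longrightarrow> partition_on {1..n} P"
      using part by blast
    have "greatest (INC_order n chi) (common_refinement \<P>) (Lower (INC_order n chi) \<P>)"
    proof (rule greatest_LowerI[OF _ _ sub])
      fix P
      assume "P \<in> \<P>"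
      then show "common_refinement \<P> \<sqsubseteq>\<^bsub>INC_order n chi\<^esub> P"
        using refines_common_refinement[OF parts] by (simp add: INC_order_def)
    next
      fix R
      assume R: "R \<in> Lower (INC_order n chi) \<P>"
      have lower: "refines {1..n} R P" if "P \<in> \<P>" for P
        using Lower_memD[OF R that sub] by (simp add: INC_order_def)
      moreover have "partition_on {1..n} R"
        using ne lower unfolding refines_def by blast
      ultimately have "refines {1..n} R (common_refinement \<P>)"
        using common_refinement_coarsest[OF parts] ne by blast
      then show "R \<sqsubseteq>\<^bsub>INC_order n chi\<^esub> common_refinement \<P>"
        by (simp add: INC_order_def)
    next
      show "common_refinement \<P> \<in> carrier (INC_order n chi)"
        using common_refinement_in_INC[OF INC ne] by (simp add: INC_order_def)
    qed
    then show "\<exists>i. greatest (INC_order n chi) i (Lower (INC_order n chi) \<P>)" ..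
  qed
qed

theorem proposition5p7:
  fixes n :: nat and chi :: "nat \<Rightarrow> colour"
  assumes "n \<ge> 1"
  shows "Lattice.lattice (INC_order n chi)"
  using INC_complete_lattice[OF assms] by (rule complete_lattice_lattice)

end
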